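(* Let $k\ge 1$ be an integer and let the memory kernel be $g(t)=\sum_{j=1}^{k+1}\theta_j\, g_j(t)$ with $\boldsymbol{\theta}=(\theta_1,\dots,\theta_{k+1})\in\mathbb{R}^{k+1}$, $\theta_1>0$ and $\theta_j\ge 0$ for every $j$. Let $\Lambda(\xi)$, $\xi\in\mathbb{R}$, be the set of roots of the associated dispersion relation. **I.** [small frequencies] There exist $r,\delta>0$ such that for $|\xi|<r$ the set $\Lambda(\xi)\cap\{\lambda\in\mathbb{C} : \mathrm{Re}\,\lambda\ge-\delta\}$ consists of a single branch $\lambda=\lambda_0(\xi)$ (i.e. it equals $\{\lambda_0(\xi)\}$), and $$\lambda_0(\xi)=-(\boldsymbol{\theta}\cdot\mathbf{1})\,\xi^2+o(\xi^2)\qquad\text{as }\xi\to0,$$ where $\mathbf{1}=(1,\dots,1)\in\mathbb{R}^{k+1}$. **II.** [large frequencies] There exist $R,\delta>0$ such that $\Lambda(\xi)\subset\{\lambda\in\mathbb{C} : \mathrm{Re}\,\lambda\le-\delta\}$ for all $|\xi|>R$ if and only if $\theta_2<\theta_1$ and all the roots of the polynomial $$Q(x)=\sum_{\ell=0}^{k}q_\ell\,x^\ell,\qquad q_\ell=\sum_{j=1}^{k+1-\ell}\binom{k+1-j}{\ell}\theta_j,$$ have strictly negative real parts.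
   Context: For integers $j\ge1$, $g_j(t)=\frac{1}{(j-1)!}t^{j-1}e^{-t}$ ($t\ge 0$) is the Gamma distribution with shape $j$ and scale $\tau=1$. For a kernel $g=\sum_{j=1}^{k+1}\theta_j g_j$, the memory diffusion equation $\partial_t u(x,t)-\int_{-\infty}^t g(t-s)\,\partial_{xx}u(x,s)\,ds=0$ is equivalent to the system, for $(u,\mathbf{v})\in\mathbb{R}^{k+2}$, $$\partial_t u+\partial_x(\boldsymbol{\theta}\cdot\mathbf{v})=0,\qquad \partial_t\mathbf{v}+\mathbf{e}_1\,\partial_x u+(\mathbb{I}_{k+1}-\mathbb{N}_{k+1})\mathbf{v}=0,$$ where $\mathbf{e}_1=(1,0,\dots,0)\in\mathbb{R}^{k+1}$, $\mathbb{I}_{k+1}$ is the identity matrix and $\mathbb{N}_{k+1}$ is the $(k+1)\times(k+1)$ matrix with $1$ on the subdiagonal and $0$ elsewhere. For $\lambda,\mu\in\mathbb{C}$ set $$p(\lambda,\mu):=\det\begin{pmatrix}\lambda & \mu\,\boldsymbol{\theta}\\ \mu\,\mathbf{e}_1 & (\lambda+1)\mathbb{I}_{k+1}-\mathbb{N}_{k+1}\end{pmatrix}$$ (a $(k+2)\times(k+2)$ determinant, with $\boldsymbol{\theta}$ regarded as a row and $\mathbf{e}_1$ as a column). The dispersion relation is $p(\lambda,\mu)=0$, and $\Lambda(\xi):=\{\lambda\in\mathbb{C} : p(\lambda,i\xi)=0\}$ for $\xi\in\mathbb{R}$. *)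

theory Defs
  imports Complex_Main "HOL-Library.Landau_Symbols" "Jordan_Normal_Form.Determinant"
begin

text \<open>Weights \<open>\<theta>\<close> are functions \<open>nat \<Rightarrow> real\<close> of which only the values at \<open>1, \<dots>, k + 1\<close>
  matter.\<close>

definition gamma_pdf :: "nat \<Rightarrow> real \<Rightarrow> real" where
  "gamma_pdf j t = t ^ (j - 1) * exp (- t) / fact (j - 1)"

definition subdiag_mat :: "nat \<Rightarrow> complex mat" where
  "subdiag_mat n = mat n n (\<lambda>(i, j). if i = j + 1 then 1 else 0)"

text \<open>Matrix indices start at 0, so column \<open>j\<close> of the row block holds \<open>\<theta> (j + 1)\<close>, and
  \<open>e\<^sub>1\<close> has its nonzero entry at index 0.\<close>

definition dispersion_mat :: "nat \<Rightarrow> (nat \<Rightarrow> real) \<Rightarrow> complex \<Rightarrow> complex \<Rightarrow> complex mat" where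
  "dispersion_mat k \<theta> l \<mu> =
     four_block_mat
       (mat 1 1 (\<lambda>_. l))
       (mat 1 (k + 1) (\<lambda>(i, j). \<mu> * complex_of_real (\<theta> (j + 1))))
       (mat (k + 1) 1 (\<lambda>(i, j). \<mu> * (if i = 0 then 1 else 0)))
       ((l + 1) \<cdot>\<^sub>m 1\<^sub>m (k + 1) - subdiag_mat (k + 1))"

definition dispersion_fun :: "nat \<Rightarrow> (nat \<Rightarrow> real) \<Rightarrow> complex \<Rightarrow> complex \<Rightarrow> complex" where
  "dispersion_fun k \<theta> l \<mu> = det (dispersion_mat k \<theta> l \<mu>)"

definition dispersion_roots :: "nat \<Rightarrow> (nat \<Rightarrow> real) \<Rightarrow> real \<Rightarrow> complex set" where
  "dispersion_roots k \<theta> \<xi> = {l. dispersion_fun k \<theta> l (\<i> * complex_of_real \<xi>) = 0}"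

definition Q_coeff :: "nat \<Rightarrow> (nat \<Rightarrow> real) \<Rightarrow> nat \<Rightarrow> real" where
  "Q_coeff k \<theta> l = (\<Sum>j = 1..k + 1 - l. real ((k + 1 - j) choose l) * \<theta> j)"

definition Q_poly :: "nat \<Rightarrow> (nat \<Rightarrow> real) \<Rightarrow> real poly" where
  "Q_poly k \<theta> = (\<Sum>l = 0..k. monom (Q_coeff k \<theta> l) l)"

end

theory Submission
  imports Defs "HOL-Analysis.Topology_Euclidean_Space"
    "HOL-Computational_Algebra.Fundamental_Theorem_Algebra"
begin

text \<open>Away from \<open>l = - 1\<close>, block elimination turns the dispersion relation into the scalar equation
  \<open>l = - \<xi>\<^sup>2 G(l)\<close>, where \<open>G(l) = \<Sum>j. \<theta> j / (l + 1) ^ j\<close> is the Laplace transform of the kernel;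
  equivalently \<open>l (l + 1) ^ (k + 1) + \<xi>\<^sup>2 Q(l) = 0\<close>, because \<open>Q(l) = (l + 1) ^ (k + 1) G(l)\<close>
  (\<open>dispersion_fun_eq\<close>, \<open>poly_Q_poly_eq\<close>).

  For small \<open>\<xi>\<close> the map \<open>l \<mapsto> - \<xi>\<^sup>2 G(l)\<close> is a contraction of the half plane \<open>Re l \<ge> - 1 / 2\<close>.
  Its unique fixed point is the branch, and it differs from \<open>- \<xi>\<^sup>2 G(0)\<close>, where \<open>G(0) = \<Sum>j. \<theta> j\<close>, by
  \<open>O(\<xi>\<^sup>4)\<close> (\<open>small_root_unique\<close>).

  For large \<open>\<xi>\<close>, \<open>k\<close> of the \<open>k + 2\<close> roots approach the roots of \<open>Q\<close>, and the other two run to infinity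
  with imaginary part close to \<open>\<plusminus> \<xi> sqrt (\<theta> 1)\<close> and real part tending to
  \<open>(\<theta> 2 / \<theta> 1 - 1) / 2\<close>. This explains the criterion. For its sufficiency, the roots of large norm
  are located by an estimate that is uniform in \<open>\<xi>\<close> (\<open>large_roots_left\<close>), and the others by
  compactness. For its necessity, the convergence of roots is replaced by a monotonicity property:
  where all roots of a polynomial lie to the left, its norm decreases as the argument, still to the
  right of them, moves to the left. Hence in a pointwise limit a zero to the right of the line that
  bounds the roots spreads to a whole segment
  (\<open>limit_zeros_propagate_left\<close>), which is impossible for \<open>Q\<close> and for the linear function
  \<open>2 z + 1 - \<theta> 2 / \<theta> 1\<close>, the two limits that occur.\<close>

section \<open>The dispersion relation as a scalar equation\<close>

text \<open>With \<open>u = 1 / (l + 1)\<close> this is the Laplace transform of the kernel at \<open>l\<close>, since the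
  transform of \<open>gamma_pdf j\<close> is \<open>1 / (l + 1) ^ j\<close>.\<close>

definition kernel_transform :: "nat \<Rightarrow> (nat \<Rightarrow> real) \<Rightarrow> complex \<Rightarrow> complex" where
  "kernel_transform n \<theta> u = (\<Sum>j = 1..n. complex_of_real (\<theta> j) * u ^ j)"

text \<open>The first column \<open>\<mu> e\<^sub>1\<close> below the corner is eliminated by column operations: the lower
  bidiagonal system with matrix \<open>(l + 1) I - N\<close> and right-hand side \<open>- \<mu> e\<^sub>1\<close> is solved by forward
  substitution, and its solution is the geometric vector \<open>X\<close> with ratio \<open>1 / (l + 1)\<close>. What
  remains in the corner is the Schur complement.\<close>

lemma dispersion_fun_eq:
  assumes "l \<noteq> - 1"
  shows "dispersion_fun k \<theta> l \<mu> =
    (l + 1) ^ (k + 1) * (l - \<mu>\<^sup>2 * kernel_transform (k + 1) \<theta> (inverse (l + 1)))"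
proof -
  define n where "n = k + 1"
  define w where "w = l + 1"
  define u where "u = inverse w"
  have "w \<noteq> 0" using assms by (simp add: w_def eq_neg_iff_add_eq_0)
  then have wu: "w * u = 1" by (simp add: u_def)
  define A where "A = Matrix.mat 1 1 (\<lambda>_ :: nat \<times> nat. l)"
  define B where "B = Matrix.mat 1 n (\<lambda>(i :: nat, j). \<mu> * complex_of_real (\<theta> (j + 1)))"
  define C where "C = Matrix.mat n 1 (\<lambda>(i :: nat, j :: nat). \<mu> * (if i = 0 then 1 else 0))"
  define D where "D = w \<cdot>\<^sub>m 1\<^sub>m n - subdiag_mat n"
  define X where "X = Matrix.mat n 1 (\<lambda>(i :: nat, j :: nat). - (\<mu> * u ^ (i + 1)))"
  define M where "M = four_block_mat A B C D"
  define U where "U = four_block_mat (1\<^sub>m 1) (0\<^sub>m 1 n) X (1\<^sub>m n)"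
  have carr: "A \<in> carrier_mat 1 1" "B \<in> carrier_mat 1 n" "C \<in> carrier_mat n 1"
    "D \<in> carrier_mat n n" "X \<in> carrier_mat n 1"
    by (auto simp: A_def B_def C_def D_def X_def subdiag_mat_def)
  have M: "dispersion_mat k \<theta> l \<mu> = M"
    by (simp add: dispersion_mat_def M_def A_def B_def C_def D_def n_def w_def)
  have D_idx: "D $$ (i, j) = (if i = j then w else 0) - (if i = j + 1 then 1 else 0)"
    if "i < n" "j < n" for i j
    using that by (simp add: D_def subdiag_mat_def)
  have DX: "C + D * X = 0\<^sub>m n 1"
  proof (rule eq_matI)
    fix i j assume "i < dim_row (0\<^sub>m n 1 :: complex mat)" "j < dim_col (0\<^sub>m n 1 :: complex mat)"
    then have i: "i < n" and j: "j = 0" by auto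
    have "(D * X) $$ (i, j) = (\<Sum>m = 0..<n. D $$ (i, m) * X $$ (m, 0))"
      using carr i j by (auto simp: scalar_prod_def intro!: sum.cong)
    also have "\<dots> = (\<Sum>m = 0..<n. (if m = i then - (w * (\<mu> * u ^ (i + 1))) else 0)
        + (if i = m + 1 then \<mu> * u ^ i else 0))"
      using i by (intro sum.cong) (auto simp: D_idx X_def algebra_simps)
    also have "\<dots> = - (w * u * (\<mu> * u ^ i)) + (if i = 0 then 0 else \<mu> * u ^ i)"
      using i by (cases i) (auto simp: sum.distrib sum.delta algebra_simps)
    finally have "(D * X) $$ (i, j) = (if i = 0 then - \<mu> else 0)"
      using wu by simp
    then show "(C + D * X) $$ (i, j) = 0\<^sub>m n 1 $$ (i, j)"
      using carr i j by (simp add: C_def)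
  qed (use carr in auto)
  have BX: "(A + B * X) $$ (0, 0) = l - \<mu>\<^sup>2 * kernel_transform n \<theta> u"
  proof -
    have "(B * X) $$ (0, 0) = (\<Sum>m = 0..<n. \<mu> * complex_of_real (\<theta> (m + 1)) * - (\<mu> * u ^ (m + 1)))"
      using carr by (auto simp: scalar_prod_def B_def X_def intro!: sum.cong)
    also have "\<dots> = - (\<mu>\<^sup>2 * (\<Sum>m = 0..<n. complex_of_real (\<theta> (m + 1)) * u ^ (m + 1)))"
      by (simp add: sum_distrib_left sum_negf power2_eq_square mult_ac)
    also have "(\<Sum>m = 0..<n. complex_of_real (\<theta> (m + 1)) * u ^ (m + 1)) = kernel_transform n \<theta> u"
      unfolding kernel_transform_def
      by (rule sum.reindex_bij_witness[of _ "\<lambda>j. j - 1" "\<lambda>m. m + 1"]) auto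
    finally show ?thesis
      using carr by (simp add: A_def)
  qed
  have "M * U = four_block_mat (A * 1\<^sub>m 1 + B * X) (A * 0\<^sub>m 1 n + B * 1\<^sub>m n)
      (C * 1\<^sub>m 1 + D * X) (C * 0\<^sub>m 1 n + D * 1\<^sub>m n)"
    unfolding M_def U_def by (rule mult_four_block_mat) (use carr in auto)
  also have "\<dots> = four_block_mat (A + B * X) B (0\<^sub>m n 1) D"
    using carr by (simp add: DX)
  finally have MU: "M * U = four_block_mat (A + B * X) B (0\<^sub>m n 1) D" .
  have "det (M * U) = det (A + B * X) * det D"
    unfolding MU by (rule det_four_block_mat_lower_left_zero) (use carr in auto)
  moreover have "det (M * U) = det M * det U"
    by (rule det_mult[of _ "1 + n"]) (use carr in \<open>auto simp: M_def U_def\<close>)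
  moreover have "det U = 1"
    unfolding U_def by (subst det_four_block_mat_upper_right_zero) (use carr in auto)
  moreover have "det (A + B * X) = l - \<mu>\<^sup>2 * kernel_transform n \<theta> u"
    using carr BX by (subst det_single) auto
  moreover have "det D = w ^ n"
  proof -
    have "det D = prod_list (diag_mat D)"
      by (rule det_lower_triangular[of n]) (use carr D_idx in auto)
    also have "\<dots> = (\<Prod>i = 0..<n. w)"
      using carr by (auto simp: prod_list_diag_prod D_idx intro!: prod.cong)
    finally show ?thesis by simp
  qed
  ultimately show ?thesis
    unfolding dispersion_fun_def M by (simp add: n_def w_def u_def)
qed

text \<open>At \<open>\<mu> = \<i> \<xi>\<close> the factor \<open>\<mu>\<^sup>2\<close> is \<open>- \<xi>\<^sup>2\<close>, so the dispersion relation becomes a fixed-point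
  equation whose right-hand side is small for small \<open>\<xi>\<close>.\<close>

lemma dispersion_roots_iff:
  assumes "l \<noteq> - 1"
  shows "l \<in> dispersion_roots k \<theta> \<xi> \<longleftrightarrow>
    l = - (complex_of_real (\<xi>\<^sup>2) * kernel_transform (k + 1) \<theta> (inverse (l + 1)))"
proof -
  have "l + 1 \<noteq> 0" using assms by (simp add: eq_neg_iff_add_eq_0)
  then show ?thesis
    by (simp add: dispersion_roots_def dispersion_fun_eq[OF assms] power_mult_distrib
        eq_neg_iff_add_eq_0)
qed

text \<open>The coefficients \<open>Q_coeff\<close> are those obtained from expanding the powers of \<open>x + 1\<close> by the
  binomial theorem and collecting powers of \<open>x\<close>; in this shifted form \<open>Q\<close> is the numerator of the
  Laplace transform of the kernel.\<close>

lemma poly_Q_poly: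
  "poly (map_poly complex_of_real (Q_poly k \<theta>)) x =
    (\<Sum>j = 1..k + 1. complex_of_real (\<theta> j) * (x + 1) ^ (k + 1 - j))"
proof -
  have "poly (map_poly complex_of_real (Q_poly k \<theta>)) x
      = (\<Sum>l = 0..k. complex_of_real (Q_coeff k \<theta> l) * x ^ l)"
  proof -
    have "map_poly complex_of_real (Q_poly k \<theta>)
        = (\<Sum>l = 0..k. monom (complex_of_real (Q_coeff k \<theta> l)) l)"
      by (rule poly_eqI) (simp add: Q_poly_def coeff_map_poly coeff_sum)
    then show ?thesis by (simp add: poly_sum poly_monom)
  qed
  also have "\<dots> = (\<Sum>l = 0..k. \<Sum>j = 1..k + 1.
      complex_of_real (\<theta> j) * (of_nat ((k + 1 - j) choose l) * x ^ l))"
  proof (rule sum.cong[OF refl])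
    fix l
    \<comment> \<open>The summands with \<open>j > k + 1 - l\<close> vanish, so both sums may run to the same bounds.\<close>
    have "Q_coeff k \<theta> l = (\<Sum>j = 1..k + 1. real ((k + 1 - j) choose l) * \<theta> j)"
      unfolding Q_coeff_def by (rule sum.mono_neutral_left) (auto simp: binomial_eq_0)
    then show "complex_of_real (Q_coeff k \<theta> l) * x ^ l = (\<Sum>j = 1..k + 1.
        complex_of_real (\<theta> j) * (of_nat ((k + 1 - j) choose l) * x ^ l))"
      by (simp only: of_real_sum sum_distrib_left sum_distrib_right of_real_mult of_real_of_nat_eq mult_ac)
  qed
  also have "\<dots> = (\<Sum>j = 1..k + 1. complex_of_real (\<theta> j) *
      (\<Sum>l = 0..k. of_nat ((k + 1 - j) choose l) * x ^ l))"
    by (subst sum.swap) (simp add: sum_distrib_left del: sum.cl_ivl_Suc)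
  also have "\<dots> = (\<Sum>j = 1..k + 1. complex_of_real (\<theta> j) * (x + 1) ^ (k + 1 - j))"
  proof (rule sum.cong[OF refl])
    fix j assume "j \<in> {1..k + 1}"
    then have "(x + 1) ^ (k + 1 - j) = (\<Sum>l = 0..k. of_nat ((k + 1 - j) choose l) * x ^ l)"
      unfolding binomial_ring by (intro sum.mono_neutral_cong_left) auto
    then show "complex_of_real (\<theta> j) * (\<Sum>l = 0..k. of_nat ((k + 1 - j) choose l) * x ^ l)
        = complex_of_real (\<theta> j) * (x + 1) ^ (k + 1 - j)" by simp
  qed
  finally show ?thesis .
qed

lemma poly_Q_poly_eq:
  assumes "x \<noteq> - 1"
  shows "poly (map_poly complex_of_real (Q_poly k \<theta>)) x =
    (x + 1) ^ (k + 1) * kernel_transform (k + 1) \<theta> (inverse (x + 1))"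
proof -
  have w: "x + 1 \<noteq> 0" using assms by (simp add: eq_neg_iff_add_eq_0)
  show ?thesis
    unfolding poly_Q_poly kernel_transform_def sum_distrib_left
  proof (rule sum.cong[OF refl])
    fix j assume "j \<in> {1..k + 1}"
    then have "(x + 1) ^ (k + 1) = (x + 1) ^ (k + 1 - j) * (x + 1) ^ j"
      by (simp flip: power_add)
    then show "complex_of_real (\<theta> j) * (x + 1) ^ (k + 1 - j) =
        (x + 1) ^ (k + 1) * (complex_of_real (\<theta> j) * inverse (x + 1) ^ j)"
      using w by (simp add: field_simps del: power_Suc)
  qed
qed

text \<open>The dispersion function at \<open>\<mu>\<^sup>2 = - e\<close> as a polynomial in \<open>l\<close>, which gives access to its
  factorization. The comparison of roots leaves out \<open>l = - 1\<close>, where a root cannot violate a gap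
  of width at most 1.\<close>

definition dispersion_poly :: "nat \<Rightarrow> (nat \<Rightarrow> real) \<Rightarrow> real \<Rightarrow> complex poly" where
  "dispersion_poly k \<theta> e = [:0, 1:] * [:1, 1:] ^ (k + 1) +
     smult (complex_of_real e) (map_poly complex_of_real (Q_poly k \<theta>))"

lemma poly_dispersion_poly:
  "poly (dispersion_poly k \<theta> e) x = x * (x + 1) ^ (k + 1) +
     complex_of_real e * poly (map_poly complex_of_real (Q_poly k \<theta>)) x"
  by (simp add: dispersion_poly_def algebra_simps)

lemma dispersion_roots_iff_poly:
  assumes "l \<noteq> - 1"
  shows "l \<in> dispersion_roots k \<theta> \<xi> \<longleftrightarrow> poly (dispersion_poly k \<theta> (\<xi>\<^sup>2)) l = 0"
proof -
  have "dispersion_fun k \<theta> l (\<i> * complex_of_real \<xi>) = poly (dispersion_poly k \<theta> (\<xi>\<^sup>2)) l"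
    unfolding dispersion_fun_eq[OF assms] poly_dispersion_poly poly_Q_poly_eq[OF assms]
    by (simp add: power_mult_distrib algebra_simps)
  then show ?thesis by (simp add: dispersion_roots_def)
qed

lemma Q_poly_nonzero:
  assumes "\<theta> 1 > 0" "\<And>j. j \<in> {1..k + 1} \<Longrightarrow> \<theta> j \<ge> 0"
  shows "map_poly complex_of_real (Q_poly k \<theta>) \<noteq> 0"
proof -
  have "0 < (\<Sum>j = 1..k + 1. \<theta> j)"
    by (rule sum_pos2[of _ 1]) (use assms in auto)
  moreover have "poly (map_poly complex_of_real (Q_poly k \<theta>)) 0 = complex_of_real (\<Sum>j = 1..k + 1. \<theta> j)"
    unfolding poly_Q_poly by simp
  ultimately show ?thesis by (metis less_irrefl of_real_eq_0_iff poly_0)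
qed

section \<open>Small frequencies\<close>

lemma norm_power_diff_le:
  fixes u v :: "'a :: {real_normed_algebra_1, comm_ring_1}"
  assumes "norm u \<le> M" "norm v \<le> M"
  shows "norm (u ^ j - v ^ j) \<le> real j * M ^ (j - 1) * norm (u - v)"
proof (induction j)
  case (Suc j)
  have M: "0 \<le> M" using assms(1) norm_ge_zero order_trans by blast
  have "u ^ Suc j - v ^ Suc j = u * (u ^ j - v ^ j) + (u - v) * v ^ j"
    by (simp add: algebra_simps)
  then have "norm (u ^ Suc j - v ^ Suc j) \<le> norm (u * (u ^ j - v ^ j)) + norm ((u - v) * v ^ j)"
    by (metis norm_triangle_ineq)
  also have "\<dots> \<le> M * (real j * M ^ (j - 1) * norm (u - v)) + norm (u - v) * M ^ j"
  proof (rule add_mono)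
    show "norm (u * (u ^ j - v ^ j)) \<le> M * (real j * M ^ (j - 1) * norm (u - v))"
      by (rule order_trans[OF norm_mult_ineq]) (intro mult_mono assms Suc.IH M norm_ge_zero)
    have "norm (v ^ j) \<le> M ^ j"
      by (rule order_trans[OF norm_power_ineq]) (intro power_mono assms norm_ge_zero)
    then show "norm ((u - v) * v ^ j) \<le> norm (u - v) * M ^ j"
      by (intro order_trans[OF norm_mult_ineq] mult_left_mono norm_ge_zero)
  qed
  also have "\<dots> = real (Suc j) * M ^ (Suc j - 1) * norm (u - v)"
    by (cases j) (simp_all add: algebra_simps)
  finally show ?case .
qed simp

lemma kernel_transform_0 [simp]: "kernel_transform n \<theta> 0 = 0"
  by (simp add: kernel_transform_def)

lemma kernel_transform_lipschitz:
  assumes "norm u \<le> M" "norm v \<le> M"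
  shows "norm (kernel_transform n \<theta> u - kernel_transform n \<theta> v)
    \<le> (\<Sum>j = 1..n. \<bar>\<theta> j\<bar> * (real j * M ^ (j - 1))) * norm (u - v)"
proof -
  have "kernel_transform n \<theta> u - kernel_transform n \<theta> v
      = (\<Sum>j = 1..n. complex_of_real (\<theta> j) * (u ^ j - v ^ j))"
    by (simp add: kernel_transform_def sum_subtractf right_diff_distrib)
  also have "norm \<dots> \<le> (\<Sum>j = 1..n. \<bar>\<theta> j\<bar> * (real j * M ^ (j - 1)) * norm (u - v))"
    by (rule sum_norm_le)
      (auto simp: norm_mult mult.assoc
        intro!: mult_left_mono order_trans[OF norm_power_diff_le[OF assms]])
  finally show ?thesis by (simp add: sum_distrib_right)
qed

lemma inverse_half_plane:
  fixes z z' :: complex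
  assumes "Re z \<ge> - 1 / 2" "Re z' \<ge> - 1 / 2"
  shows "norm (inverse (z + 1)) \<le> 2"
    and "norm (inverse (z + 1) - inverse (z' + 1)) \<le> 4 * norm (z - z')"
proof -
  have inv: "y + 1 \<noteq> 0 \<and> norm (inverse (y + 1)) \<le> 2" if "Re y \<ge> - 1 / 2" for y
  proof -
    have "1 / 2 \<le> norm (y + 1)"
      using that complex_Re_le_cmod[of "y + 1"] by simp
    then show ?thesis
      by (auto simp: inverse_eq_divide norm_divide divide_le_eq)
  qed
  show "norm (inverse (z + 1)) \<le> 2" using inv[OF assms(1)] by simp
  have "inverse (z + 1) - inverse (z' + 1) = - (inverse (z + 1) * (z - z') * inverse (z' + 1))"
    using inv[OF assms(1)] inv[OF assms(2)] by (subst inverse_diff_inverse) auto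
  then have "norm (inverse (z + 1) - inverse (z' + 1))
      = (norm (inverse (z + 1)) * norm (inverse (z' + 1))) * norm (z - z')"
    by (simp add: norm_mult)
  also have "\<dots> \<le> (2 * 2) * norm (z - z')"
    using inv[OF assms(1)] inv[OF assms(2)] by (intro mult_mono) auto
  finally show "norm (inverse (z + 1) - inverse (z' + 1)) \<le> 4 * norm (z - z')" by simp
qed

text \<open>The right-hand side of the fixed-point equation maps the half plane \<open>Re z \<ge> - 1 / 2\<close> into itself
  and contracts there with factor \<open>4 L e \<le> 1 / 2\<close>, because \<open>1 / (z + 1)\<close> has norm at most 2 and
  Lipschitz constant 4 on this half plane. Feeding the fixed point, which is of order \<open>e\<close>, once more
  into the Lipschitz estimate compares it with the image of 0, which is the leading term.\<close>

lemma small_root_unique: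
  fixes n \<theta>
  defines "L \<equiv> 1 + (\<Sum>j = 1..n. \<bar>\<theta> j\<bar> * (real j * 2 ^ (j - 1)))"
  assumes "0 \<le> e" "8 * L * e \<le> 1"
  shows "\<exists>!z. Re z \<ge> - 1 / 2 \<and> z = - (complex_of_real e * kernel_transform n \<theta> (inverse (z + 1)))"
    and "Re z \<ge> - 1 / 2 \<Longrightarrow> z = - (complex_of_real e * kernel_transform n \<theta> (inverse (z + 1)))
      \<Longrightarrow> norm (z - (- complex_of_real (e * (\<Sum>j = 1..n. \<theta> j)))) \<le> 8 * L\<^sup>2 * e\<^sup>2"
proof -
  define G where "G = kernel_transform n \<theta>"
  define T where "T z = - (complex_of_real e * G (inverse (z + 1)))" for z
  define H where "H = {z :: complex. Re z \<ge> - 1 / 2}"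
  have L: "L \<ge> 1" by (simp add: L_def sum_nonneg)
  have lip: "norm (G u - G v) \<le> L * norm (u - v)" if "norm u \<le> 2" "norm v \<le> 2" for u v
    unfolding G_def L_def
    by (rule order_trans[OF kernel_transform_lipschitz[OF that]]) (auto intro!: mult_right_mono)
  have T_le: "norm (T z) \<le> 2 * L * e" if "z \<in> H" for z
  proof -
    have z: "norm (inverse (z + 1)) \<le> 2" using that inverse_half_plane by (auto simp: H_def)
    have "norm (G (inverse (z + 1))) \<le> L * norm (inverse (z + 1))"
      using lip[OF z, of 0] by (simp add: G_def)
    also have "\<dots> \<le> L * 2" using z L by (intro mult_left_mono) auto
    finally have "e * norm (G (inverse (z + 1))) \<le> e * (L * 2)"
      using assms(2) by (rule mult_left_mono)
    then show ?thesis
      using assms(2) by (simp add: T_def norm_mult mult_ac)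
  qed
  have T_lip: "norm (T z - T z') \<le> e * (L * (4 * norm (z - z')))" if "z \<in> H" "z' \<in> H" for z z'
  proof -
    have zz: "Re z \<ge> - 1 / 2" "Re z' \<ge> - 1 / 2" using that by (auto simp: H_def)
    have "norm (T z - T z') = e * norm (G (inverse (z + 1)) - G (inverse (z' + 1)))"
      using assms(2) by (simp add: T_def norm_mult norm_minus_commute flip: right_diff_distrib)
    also have "norm (G (inverse (z + 1)) - G (inverse (z' + 1)))
        \<le> L * norm (inverse (z + 1) - inverse (z' + 1))"
      using inverse_half_plane[OF zz] inverse_half_plane[OF zz(2,1)] by (intro lip) auto
    also have "\<dots> \<le> L * (4 * norm (z - z'))"
      using inverse_half_plane[OF zz] L by (intro mult_left_mono) auto
    finally show ?thesis using assms(2) by (simp add: mult_left_mono)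
  qed
  have "\<exists>!z. z \<in> H \<and> T z = z"
  proof (rule Banach_fix[of H "1 / 2"])
    have "H = Re -` {- 1 / 2..}" by (auto simp: H_def)
    then have "closed H"
      by (auto intro!: closed_vimage continuous_intros)
    then show "complete H" by (simp add: complete_eq_closed)
    show "H \<noteq> {}" by (auto simp: H_def intro!: exI[of _ 0])
    show "T ` H \<subseteq> H"
    proof clarify
      fix z assume "z \<in> H"
      then have "norm (T z) \<le> 1 / 2" using T_le[of z] assms(3) by linarith
      then show "T z \<in> H" using abs_Re_le_cmod[of "T z"] by (simp add: H_def)
    qed
    fix z z' assume "z \<in> H" "z' \<in> H"
    then have "norm (T z - T z') \<le> (8 * L * e) / 2 * norm (z - z')"
      using T_lip[of z z'] by (simp add: mult_ac)
    also have "\<dots> \<le> 1 / 2 * norm (z - z')"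
      using assms(3) by (intro mult_right_mono) auto
    finally show "dist (T z) (T z') \<le> 1 / 2 * dist z z'" by (simp add: dist_norm)
  qed auto
  then show "\<exists>!z. Re z \<ge> - 1 / 2 \<and> z = - (complex_of_real e * kernel_transform n \<theta> (inverse (z + 1)))"
    by (simp add: H_def T_def G_def eq_commute)
  assume z: "Re z \<ge> - 1 / 2" "z = - (complex_of_real e * kernel_transform n \<theta> (inverse (z + 1)))"
  have Tz: "T z = z" using z(2) by (simp add: T_def G_def)
  have "T 0 = - complex_of_real (e * (\<Sum>j = 1..n. \<theta> j))"
    by (simp add: T_def G_def kernel_transform_def)
  then have "norm (z - (- complex_of_real (e * (\<Sum>j = 1..n. \<theta> j)))) = norm (T z - T 0)"
    by (simp only: Tz)
  also have "\<dots> \<le> e * (L * (4 * norm z))" using T_lip[of z 0] z by (simp add: H_def)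
  also have "\<dots> \<le> e * (L * (4 * (2 * L * e)))"
    using T_le[of z] z Tz L assms(2) by (intro mult_left_mono) (auto simp: H_def)
  finally show "norm (z - (- complex_of_real (e * (\<Sum>j = 1..n. \<theta> j)))) \<le> 8 * L\<^sup>2 * e\<^sup>2"
    by (simp add: power2_eq_square mult_ac)
qed

text \<open>The threshold \<open>r \<le> 1\<close> gives \<open>\<xi>\<^sup>2 \<le> \<bar>\<xi>\<bar>\<close>, so that bounds on \<open>\<bar>\<xi>\<bar>\<close> can be used directly as
  bounds on \<open>\<xi>\<^sup>2\<close>.\<close>

lemma small_frequencies:
  "\<exists>r > 0. \<exists>\<delta> > 0. \<exists>lam0 :: real \<Rightarrow> complex.
        (\<forall>\<xi>. \<bar>\<xi>\<bar> < r \<longrightarrow> dispersion_roots k \<theta> \<xi> \<inter> {z. Re z \<ge> - \<delta>} = {lam0 \<xi>}) \<and>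
        (\<lambda>\<xi>. lam0 \<xi> - complex_of_real (- (\<Sum>j = 1..k + 1. \<theta> j) * \<xi>\<^sup>2))
          \<in> o[at 0](\<lambda>\<xi>. complex_of_real (\<xi>\<^sup>2))"
proof -
  define L where "L = 1 + (\<Sum>j = 1..k + 1. \<bar>\<theta> j\<bar> * (real j * 2 ^ (j - 1)))"
  define r where "r = 1 / (8 * L)"
  define root where "root \<xi> z \<longleftrightarrow> Re z \<ge> - 1 / 2 \<and>
    z = - (complex_of_real (\<xi>\<^sup>2) * kernel_transform (k + 1) \<theta> (inverse (z + 1)))" for \<xi> :: real and z
  define lam0 where "lam0 \<xi> = (THE z. root \<xi> z)" for \<xi>
  have L: "L \<ge> 1" by (simp add: L_def sum_nonneg del: sum.cl_ivl_Suc)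
  then have r: "0 < r" "r \<le> 1" by (auto simp: r_def)
  have sq_le: "\<xi>\<^sup>2 \<le> \<bar>\<xi>\<bar>" if "\<bar>\<xi>\<bar> < r" for \<xi> :: real
  proof -
    have "\<bar>\<xi>\<bar> * \<bar>\<xi>\<bar> \<le> \<bar>\<xi>\<bar> * 1" using that r by (intro mult_left_mono) auto
    then show ?thesis by (simp add: power2_eq_square)
  qed
  have small: "8 * L * \<xi>\<^sup>2 \<le> 1" if "\<bar>\<xi>\<bar> < r" for \<xi>
  proof -
    have "\<xi>\<^sup>2 \<le> r" using sq_le[OF that] that by simp
    then have "8 * L * \<xi>\<^sup>2 \<le> 8 * L * r" using L by (intro mult_left_mono) auto
    then show ?thesis using L by (simp add: r_def)
  qed
  have ex1: "\<exists>!z. root \<xi> z" if "\<bar>\<xi>\<bar> < r" for \<xi>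
    unfolding root_def
    by (rule small_root_unique(1)) (use small[OF that] in \<open>simp_all add: L_def del: sum.cl_ivl_Suc\<close>)
  have lam0: "root \<xi> (lam0 \<xi>)" if "\<bar>\<xi>\<bar> < r" for \<xi>
    unfolding lam0_def by (rule theI') (rule ex1[OF that])
  have "dispersion_roots k \<theta> \<xi> \<inter> {z. Re z \<ge> - (1 / 2)} = {lam0 \<xi>}" if "\<bar>\<xi>\<bar> < r" for \<xi>
  proof -
    have "z \<in> dispersion_roots k \<theta> \<xi> \<inter> {z. Re z \<ge> - (1 / 2)} \<longleftrightarrow> root \<xi> z" for z
      using dispersion_roots_iff[of z k \<theta> \<xi>] by (cases "z = - 1") (auto simp: root_def)
    then show ?thesis using lam0[OF that] ex1[OF that] by blast
  qed
  moreover have "(\<lambda>\<xi>. lam0 \<xi> - complex_of_real (- (\<Sum>j = 1..k + 1. \<theta> j) * \<xi>\<^sup>2))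
      \<in> o[at 0](\<lambda>\<xi>. complex_of_real (\<xi>\<^sup>2))"
  proof (rule landau_o.smallI)
    fix c :: real assume c: "c > 0"
    define d where "d = min r (c / (8 * L\<^sup>2))"
    have d: "d > 0" using c r L by (simp add: d_def)
    have "norm (lam0 \<xi> - complex_of_real (- (\<Sum>j = 1..k + 1. \<theta> j) * \<xi>\<^sup>2))
        \<le> c * norm (complex_of_real (\<xi>\<^sup>2))" if "\<bar>\<xi>\<bar> < d" for \<xi>
    proof -
      have \<xi>: "\<bar>\<xi>\<bar> < r" "\<bar>\<xi>\<bar> \<le> c / (8 * L\<^sup>2)" using that by (auto simp: d_def)
      have "norm (lam0 \<xi> - (- complex_of_real (\<xi>\<^sup>2 * (\<Sum>j = 1..k + 1. \<theta> j)))) \<le> 8 * L\<^sup>2 * (\<xi>\<^sup>2)\<^sup>2"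
        unfolding L_def
        by (rule small_root_unique(2))
          (use small[OF \<xi>(1)] lam0[OF \<xi>(1)] in \<open>simp_all add: L_def root_def del: sum.cl_ivl_Suc\<close>)
      also have "\<dots> = (8 * L\<^sup>2 * \<xi>\<^sup>2) * \<xi>\<^sup>2" by (simp add: power2_eq_square)
      also have "\<dots> \<le> c * \<xi>\<^sup>2"
      proof (rule mult_right_mono)
        have "\<xi>\<^sup>2 \<le> c / (8 * L\<^sup>2)" using sq_le[OF \<xi>(1)] \<xi>(2) by simp
        then show "8 * L\<^sup>2 * \<xi>\<^sup>2 \<le> c" using L by (simp add: field_simps)
      qed simp
      finally show ?thesis by (simp add: mult.commute norm_power del: sum.cl_ivl_Suc)
    qed
    then show "\<forall>\<^sub>F \<xi> in at 0. norm (lam0 \<xi> - complex_of_real (- (\<Sum>j = 1..k + 1. \<theta> j) * \<xi>\<^sup>2))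
        \<le> c * norm (complex_of_real (\<xi>\<^sup>2))"
      using d by (auto simp: eventually_at dist_real_def simp del: sum.cl_ivl_Suc intro!: exI[of _ d])
  qed
  ultimately show ?thesis
    using r by (intro exI[of _ r] conjI exI[of _ "1/2 :: real"] exI[of _ lam0]) auto
qed

section \<open>Large frequencies: sufficiency of the criterion\<close>

lemma kernel_transform_head:
  assumes "n \<ge> 2"
  shows "kernel_transform n \<theta> u = u * (complex_of_real (\<theta> 1) + complex_of_real (\<theta> 2) * u
    + u\<^sup>2 * (\<Sum>j = 3..n. complex_of_real (\<theta> j) * u ^ (j - 3)))"
proof -
  have "kernel_transform n \<theta> u = complex_of_real (\<theta> 1) * u + complex_of_real (\<theta> 2) * u\<^sup>2
      + (\<Sum>j = 3..n. complex_of_real (\<theta> j) * u ^ j)"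
    using assms unfolding kernel_transform_def
    by (simp add: sum.atLeast_Suc_atMost numeral_2_eq_2 numeral_3_eq_3)
  also have "(\<Sum>j = 3..n. complex_of_real (\<theta> j) * u ^ j)
      = (\<Sum>j = 3..n. u * (u\<^sup>2 * (complex_of_real (\<theta> j) * u ^ (j - 3))))"
  proof (rule sum.cong[OF refl])
    fix j assume "j \<in> {3..n}"
    then have "u ^ j = u ^ 3 * u ^ (j - 3)" by (simp flip: power_add)
    then show "complex_of_real (\<theta> j) * u ^ j = u * (u\<^sup>2 * (complex_of_real (\<theta> j) * u ^ (j - 3)))"
      by (simp add: power2_eq_square power3_eq_cube)
  qed
  finally show ?thesis
    by (simp add: sum_distrib_left algebra_simps power2_eq_square)
qed

text \<open>Let \<open>w = l + 1\<close> and \<open>b = \<theta> 2 / \<theta> 1 < 1\<close>. The equation \<open>w - 1 + e (\<theta> 1 / w + \<theta> 2 / w\<^sup>2 + \<dots>) = 0\<close>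
  makes \<open>(w - 1) (w - b) + e \<theta> 1\<close> bounded, uniformly in \<open>e\<close>. As \<open>e\<close> is real, the imaginary part
  \<open>Im w (2 Re w - 1 - b)\<close> is bounded, and so is \<open>Im w\<close> if \<open>Re w \<ge> 1 - (1 - b) / 4\<close>, since this
  exceeds \<open>(1 + b) / 2\<close>. As \<open>e\<close> is moreover nonnegative, the real part then bounds \<open>Re w\<close> too, so
  that \<open>w\<close> cannot be large.\<close>

lemma large_roots_left:
  fixes \<theta> :: "nat \<Rightarrow> real"
  assumes n: "n \<ge> 2" and pos: "\<theta> 1 > 0" and nonneg: "\<And>j. j \<in> {1..n} \<Longrightarrow> \<theta> j \<ge> 0"
    and lt: "\<theta> 2 < \<theta> 1"
  obtains W \<delta> where "W \<ge> 1" "0 < \<delta>" "\<delta> < 1"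
    "\<And>l e. 0 \<le> e \<Longrightarrow> W \<le> norm (l + 1) \<Longrightarrow>
      l = - (complex_of_real e * kernel_transform n \<theta> (inverse (l + 1))) \<Longrightarrow> Re l < - \<delta>"
proof -
  define b where "b = \<theta> 2 / \<theta> 1"
  have b: "0 \<le> b" "b < 1" using pos nonneg[of 2] lt n by (auto simp: b_def)
  have b\<theta>: "b * \<theta> 1 = \<theta> 2" using pos by (simp add: b_def)
  define T where "T = (\<Sum>j = 3..n. \<theta> j)"
  have T: "0 \<le> T" unfolding T_def by (rule sum_nonneg) (use nonneg in auto)
  have th2: "0 \<le> \<theta> 2" using nonneg[of 2] n by auto
  define C where "C = T + \<theta> 2 + T"
  define K where "K = 8 * C / \<theta> 1"
  define Y where "Y = 4 * K / (1 - b)"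
  define W where "W = 4 + 2 * C / \<theta> 1 + K + Y\<^sup>2 + Y"
  define \<delta> where "\<delta> = (1 - b) / 4"
  have C: "0 \<le> C" using T th2 by (simp add: C_def)
  have K: "0 \<le> K" using C pos by (simp add: K_def)
  have Y: "0 \<le> Y" using K b by (simp add: Y_def)
  have CW: "0 \<le> 2 * C / \<theta> 1" using C pos by simp
  have W1: "1 \<le> W" using K Y CW by (simp add: W_def)
  have main: "Re l < - \<delta>" if e: "0 \<le> e" and lW: "W \<le> norm (l + 1)"
    and eq: "l = - (complex_of_real e * kernel_transform n \<theta> (inverse (l + 1)))" for l e
  proof (rule ccontr)
    assume "\<not> Re l < - \<delta>"
    define w where "w = l + 1"
    define u where "u = inverse w"
    define h where "h = (\<Sum>j = 3..n. complex_of_real (\<theta> j) * u ^ (j - 3))"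
    define g where "g = h - complex_of_real b * complex_of_real (\<theta> 2) - complex_of_real b * u * h"
    have Wn: "W \<le> norm w" and n1: "1 \<le> norm w" using lW W1 by (auto simp: w_def)
    then have w0: "w \<noteq> 0" by auto
    have u1: "norm u \<le> 1" using n1 by (simp add: u_def norm_inverse inverse_le_1_iff)
    have h: "norm h \<le> T"
      unfolding h_def T_def
    proof (rule sum_norm_le)
      fix j assume j: "j \<in> {3..n}"
      have "norm (u ^ (j - 3)) \<le> 1" using u1 by (simp add: norm_power power_le_one)
      then show "norm (complex_of_real (\<theta> j) * u ^ (j - 3)) \<le> \<theta> j"
        using nonneg[of j] j by (auto simp: norm_mult mult_left_le)
    qed
    have g: "norm g \<le> C"
    proof -
      have "norm g \<le> norm h + norm (complex_of_real b * complex_of_real (\<theta> 2)) + norm (complex_of_real b * u * h)"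
        unfolding g_def by (intro order_trans[OF norm_triangle_ineq4] add_right_mono norm_triangle_ineq4)
      moreover have "norm (complex_of_real b * complex_of_real (\<theta> 2)) \<le> \<theta> 2"
        using b th2 by (simp add: norm_mult mult_left_le_one_le)
      moreover have "norm (complex_of_real b * u * h) \<le> 1 * 1 * T"
        unfolding norm_mult using b u1 h by (intro mult_mono) auto
      ultimately show ?thesis using h by (simp add: C_def)
    qed
    \<comment> \<open>Multiplying by \<open>w - b\<close> removes the term of order \<open>1 / w\<close>.\<close>
    have uw: "u * w = 1" using w0 by (simp add: u_def)
    have "w - 1 + complex_of_real e * (u * (\<theta> 1 + \<theta> 2 * u + u\<^sup>2 * h)) = 0"
      using eq[unfolded eq_neg_iff_add_eq_0] unfolding kernel_transform_head[OF n]
      by (simp add: w_def u_def h_def)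
    then have "(w - b) * (w - 1 + complex_of_real e * (u * (\<theta> 1 + \<theta> 2 * u + u\<^sup>2 * h))) = 0"
      by simp
    also have "(w - b) * (w - 1 + complex_of_real e * (u * (\<theta> 1 + \<theta> 2 * u + u\<^sup>2 * h)))
        = (w - 1) * (w - b) + e * ((u * w - b * u) * (\<theta> 1 + \<theta> 2 * u + u\<^sup>2 * h))"
      by (simp add: algebra_simps)
    also have "(u * w - b * u) * (\<theta> 1 + \<theta> 2 * u + u\<^sup>2 * h)
        = complex_of_real (\<theta> 1) + (complex_of_real (\<theta> 2) - complex_of_real (b * \<theta> 1)) * u + u\<^sup>2 * g"
      unfolding uw g_def by (simp add: algebra_simps power2_eq_square)
    finally have key: "(w - 1) * (w - b) + complex_of_real e * (\<theta> 1 + u\<^sup>2 * g) = 0"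
      unfolding b\<theta> by simp
    \<comment> \<open>First \<open>e\<close> is bounded by a multiple of \<open>\<bar>w\<bar>\<^sup>2\<close>, which is what makes the error term
      \<open>e u\<^sup>2 g\<close> bounded.\<close>
    have sq: "norm w \<le> (norm w)\<^sup>2" using n1 by (rule self_le_power) simp
    have ug: "norm (u\<^sup>2 * g) \<le> C / (norm w)\<^sup>2"
      using g by (simp add: norm_mult norm_power u_def norm_inverse divide_inverse power_inverse
          mult.commute mult_right_mono)
    have "2 * C / \<theta> 1 \<le> W" using K Y by (simp add: W_def)
    then have "2 * C / \<theta> 1 \<le> (norm w)\<^sup>2" using Wn sq by simp
    then have "C / (norm w)\<^sup>2 \<le> \<theta> 1 / 2" using pos w0 by (simp add: field_simps)
    then have ug2: "norm (u\<^sup>2 * g) \<le> \<theta> 1 / 2" by (rule order_trans[OF ug])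
    have "\<theta> 1 / 2 \<le> norm (complex_of_real (\<theta> 1) + u\<^sup>2 * g)"
      using norm_diff_ineq[of "complex_of_real (\<theta> 1)" "u\<^sup>2 * g"] ug2 pos by simp
    then have "e * (\<theta> 1 / 2) \<le> e * norm (complex_of_real (\<theta> 1) + u\<^sup>2 * g)"
      using e by (rule mult_left_mono)
    also have "\<dots> = norm (complex_of_real e * (\<theta> 1 + u\<^sup>2 * g))" using e by (simp add: norm_mult)
    also have "complex_of_real e * (\<theta> 1 + u\<^sup>2 * g) = - ((w - 1) * (w - b))"
      using key by (simp add: add_eq_0_iff2 add.commute)
    also have "norm (- ((w - 1) * (w - b))) = norm (w - 1) * norm (w - b)" by (simp add: norm_mult)
    also have "\<dots> \<le> (2 * norm w) * (2 * norm w)"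
    proof (rule mult_mono)
      show "norm (w - 1) \<le> 2 * norm w" using norm_triangle_ineq4[of w 1] n1 by simp
      show "norm (w - complex_of_real b) \<le> 2 * norm w"
        using norm_triangle_ineq4[of w "complex_of_real b"] n1 b by simp
    qed auto
    finally have e_le: "e \<le> 8 * (norm w)\<^sup>2 / \<theta> 1"
      using pos by (simp add: field_simps power2_eq_square)
    define z where "z = (w - 1) * (w - b) + complex_of_real (e * \<theta> 1)"
    have "norm z = e * norm (u\<^sup>2 * g)"
    proof -
      have "z = - (complex_of_real e * (u\<^sup>2 * g))"
        using key by (simp add: z_def algebra_simps eq_neg_iff_add_eq_0)
      then show ?thesis using e by (simp add: norm_mult)
    qed
    also have "\<dots> \<le> 8 * (norm w)\<^sup>2 / \<theta> 1 * (C / (norm w)\<^sup>2)"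
      using e_le ug e pos by (intro mult_mono) auto
    also have "\<dots> = K" using w0 by (simp add: K_def)
    finally have z: "norm z \<le> K" .
    define x y where "x = Re w" and "y = Im w"
    have x: "1 - \<delta> \<le> x" using \<open>\<not> Re l < - \<delta>\<close> by (simp add: x_def w_def)
    then have x4: "3 + b \<le> 4 * x" by (simp add: \<delta>_def field_simps)
    then have xb: "(1 - b) / 2 \<le> 2 * x - (1 + b)" by (simp add: field_simps)
    have x0: "0 \<le> x" using x4 b by linarith
    have Imz: "Im z = y * (2 * x - (1 + b))"
      by (simp add: z_def x_def y_def algebra_simps)
    have Rez: "Re z = x\<^sup>2 - y\<^sup>2 - (1 + b) * x + b + e * \<theta> 1"
      by (simp add: z_def x_def y_def algebra_simps power2_eq_square)
    have "\<bar>y\<bar> * ((1 - b) / 2) \<le> \<bar>y\<bar> * (2 * x - (1 + b))" using xb by (intro mult_left_mono) auto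
    also have "\<dots> = \<bar>Im z\<bar>" using xb b by (simp add: Imz abs_mult)
    also have "\<dots> \<le> K" using abs_Im_le_cmod[of z] z by simp
    finally have y: "\<bar>y\<bar> \<le> Y / 2" using b by (simp add: Y_def field_simps)
    then have "y\<^sup>2 \<le> Y\<^sup>2" using Y by (subst abs_le_square_iff[symmetric]) auto
    moreover have "Re z \<le> K" using complex_Re_le_cmod[of z] z by simp
    moreover have "0 \<le> e * \<theta> 1" using e pos by simp
    moreover have "(1 + b) * x \<le> 2 * x" using b x0 by (intro mult_right_mono) auto
    ultimately have "x\<^sup>2 - 2 * x \<le> K + Y\<^sup>2" using Rez b by linarith
    moreover have "4 * x \<le> x\<^sup>2 + 4"
      using zero_le_power2[of "x - 2"] by (simp add: power2_eq_square algebra_simps)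
    ultimately have "2 * x \<le> K + Y\<^sup>2 + 4" by linarith
    moreover have "norm w \<le> x + \<bar>y\<bar>" using cmod_le[of w] x0 by (simp add: x_def y_def)
    ultimately have "norm w \<le> K / 2 + Y\<^sup>2 / 2 + 2 + Y / 2" using y by simp
    moreover have "K / 2 + Y\<^sup>2 / 2 + 2 + Y / 2 < W"
      using K Y CW zero_le_power2[of Y] unfolding W_def by linarith
    ultimately show False using Wn by simp
  qed
  show thesis
    by (rule that[of W \<delta>]) (use main W1 b in \<open>auto simp: \<delta>_def\<close>)
qed

text \<open>Roots far from \<open>- 1\<close> are controlled for every frequency by the expansion at infinity. In the
  remaining disc, a closed part that leaves all roots of \<open>Q\<close> strictly to its left is compact, so
  \<open>Q\<close> is bounded away from zero there, and \<open>\<xi>\<^sup>2 Q(l) = - l (l + 1) ^ (k + 1)\<close> fails for large \<open>\<xi>\<close>.\<close>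

lemma large_frequencies_sufficient:
  assumes k: "k \<ge> 1" and pos: "\<theta> 1 > 0" and nonneg: "\<And>j. j \<in> {1..k + 1} \<Longrightarrow> \<theta> j \<ge> 0"
    and lt: "\<theta> 2 < \<theta> 1"
    and stable: "\<And>x. poly (map_poly complex_of_real (Q_poly k \<theta>)) x = 0 \<Longrightarrow> Re x < 0"
  shows "\<exists>R > 0. \<exists>\<delta> > 0. \<forall>\<xi>. \<bar>\<xi>\<bar> > R \<longrightarrow> dispersion_roots k \<theta> \<xi> \<subseteq> {z. Re z \<le> - \<delta>}"
proof -
  define q where "q = map_poly complex_of_real (Q_poly k \<theta>)"
  have n2: "k + 1 \<ge> 2" using k by simp
  obtain W \<delta>1 where W: "W \<ge> 1" and \<delta>1: "0 < \<delta>1" "\<delta>1 < 1"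
    and far: "\<And>l e. 0 \<le> e \<Longrightarrow> W \<le> norm (l + 1) \<Longrightarrow>
      l = - (complex_of_real e * kernel_transform (k + 1) \<theta> (inverse (l + 1))) \<Longrightarrow> Re l < - \<delta>1"
    using large_roots_left[of "k + 1" \<theta>, OF n2 pos nonneg lt] by blast
  \<comment> \<open>The element 1 only guards against an empty minimum.\<close>
  define S where "S = insert 1 ((\<lambda>x. - Re x) ` {x. poly q x = 0})"
  define \<delta>2 where "\<delta>2 = Min S / 2"
  have "finite S"
    using poly_roots_finite[OF Q_poly_nonzero[of \<theta>, OF pos nonneg]] by (auto simp: S_def q_def)
  moreover have "s > 0" if "s \<in> S" for s using that stable by (auto simp: S_def q_def)
  ultimately have "0 < Min S" and Min_le: "\<And>s. s \<in> S \<Longrightarrow> Min S \<le> s"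
    by (auto simp: S_def)
  then have \<delta>2: "\<delta>2 > 0" and q_roots: "\<And>x. poly q x = 0 \<Longrightarrow> Re x < - \<delta>2"
    by (auto simp: \<delta>2_def S_def) (smt (verit) Min_le S_def image_eqI insertCI mem_Collect_eq field_sum_of_halves)
  define N where "N = cball (- 1) W \<inter> Re -` {- \<delta>2..}"
  have "compact N"
    unfolding N_def by (intro compact_Int_closed closed_vimage continuous_intros) auto
  moreover have "0 \<in> N" using W \<delta>2 by (simp add: N_def)
  then have "N \<noteq> {}" by blast
  ultimately obtain x0 where x0: "x0 \<in> N" "\<And>x. x \<in> N \<Longrightarrow> norm (poly q x0) \<le> norm (poly q x)"
    using continuous_attains_inf[of N "\<lambda>x. norm (poly q x)"] continuous_on_norm[OF continuous_on_poly[OF continuous_on_id]]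
    by blast
  define m where "m = norm (poly q x0)"
  have m: "m > 0" using x0(1) q_roots[of x0] by (auto simp: m_def N_def)
  define B where "B = (W + 1) * W ^ (k + 1)"
  have B: "B \<ge> 0" using W by (simp add: B_def)
  define \<delta> where "\<delta> = min \<delta>1 \<delta>2"
  have "Re l \<le> - \<delta>" if \<xi>: "\<bar>\<xi>\<bar> > 1 + B / m" and l: "l \<in> dispersion_roots k \<theta> \<xi>" for \<xi> l
  proof (rule ccontr)
    assume neg: "\<not> Re l \<le> - \<delta>"
    then have l1: "l \<noteq> - 1" using \<delta>1 by (auto simp: \<delta>_def)
    have "\<not> W \<le> norm (l + 1)"
      using far[of "\<xi>\<^sup>2" l] l dispersion_roots_iff[OF l1] neg by (auto simp: \<delta>_def)
    then have lW: "norm (l + 1) \<le> W" by simp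
    then have "l \<in> N" using neg by (auto simp: N_def \<delta>_def dist_norm norm_minus_commute add.commute)
    have "poly (dispersion_poly k \<theta> (\<xi>\<^sup>2)) l = 0" using l dispersion_roots_iff_poly[OF l1] by simp
    then have eq: "complex_of_real (\<xi>\<^sup>2) * poly q l = - (l * (l + 1) ^ (k + 1))"
      unfolding poly_dispersion_poly q_def by (simp add: add_eq_0_iff)
    have "\<xi>\<^sup>2 * m \<le> \<xi>\<^sup>2 * norm (poly q l)"
      using x0(2)[OF \<open>l \<in> N\<close>] by (simp add: m_def mult_left_mono)
    also have "\<dots> = norm (complex_of_real (\<xi>\<^sup>2) * poly q l)" by (simp add: norm_mult norm_power)
    also have "\<dots> = norm l * norm (l + 1) ^ (k + 1)" unfolding eq by (simp add: norm_mult norm_power)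
    also have "\<dots> \<le> (W + 1) * W ^ (k + 1)"
    proof (intro mult_mono power_mono lW)
      show "norm l \<le> W + 1" using norm_triangle_ineq4[of "l + 1" 1] lW by simp
    qed (use W in auto)
    finally have "\<xi>\<^sup>2 \<le> B / m" using m by (simp add: B_def field_simps)
    moreover have "1 < \<bar>\<xi>\<bar>" using \<xi> B m by (smt (verit) divide_nonneg_pos)
    then have "\<bar>\<xi>\<bar> * 1 \<le> \<bar>\<xi>\<bar> * \<bar>\<xi>\<bar>" by (intro mult_left_mono) auto
    then have "\<bar>\<xi>\<bar> \<le> \<xi>\<^sup>2" by (simp add: power2_eq_square)
    ultimately show False using \<xi> by linarith
  qed
  moreover have "0 < 1 + B / m" using B m by (simp add: add_pos_nonneg)
  moreover have "0 < \<delta>" using \<delta>1 \<delta>2 by (simp add: \<delta>_def)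
  ultimately show ?thesis by blast
qed

section \<open>Zeros of limits of polynomials with a spectral gap\<close>

text \<open>The bound on \<open>s\<close> says that the midpoint of \<open>x\<close> and its translate does not lie to the left of any
  root, so the distance to each root does not increase, and the norm of the polynomial is, up to a constant,
  the product of these distances.\<close>

lemma norm_poly_shift_left_le:
  fixes p :: "complex poly"
  assumes roots: "\<And>z. poly p z = 0 \<Longrightarrow> Re z \<le> - d"
    and s: "0 \<le> s" "s \<le> 2 * (Re x + d)"
  shows "norm (poly p (x - complex_of_real s)) \<le> norm (poly p x)"
proof -
  have shift: "norm (x - complex_of_real s - z) \<le> norm (x - z)" if "Re z \<le> - d" for z
  proof -
    define a where "a = Re x - Re z"
    have "s * s \<le> s * (2 * a)" using s that by (intro mult_left_mono) (auto simp: a_def)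
    then have "(a - s)\<^sup>2 \<le> a\<^sup>2" by (simp add: power2_eq_square algebra_simps)
    then have "(norm (x - complex_of_real s - z))\<^sup>2 \<le> (norm (x - z))\<^sup>2"
      by (simp add: cmod_power2 a_def algebra_simps)
    then show ?thesis by (rule power2_le_imp_le) simp
  qed
  have eval: "poly p y = lead_coeff p * (\<Prod>z | poly p z = 0. (y - z) ^ order z p)" for y
  proof -
    have "poly p y = poly (smult (lead_coeff p) (\<Prod>z | poly p z = 0. [:- z, 1:] ^ order z p)) y"
      by (simp only: complex_poly_decompose)
    then show ?thesis by (simp add: poly_prod)
  qed
  show ?thesis
    unfolding eval[of x] eval[of "x - complex_of_real s"]
    by (auto simp: norm_mult prod_norm[symmetric] norm_power roots
        intro!: mult_left_mono prod_mono power_mono shift)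
qed

text \<open>The previous inequality survives pointwise limits. A limit \<open>f\<close> with isolated zeros therefore
  has none to the right of the line \<open>Re z = - d\<close>: this replaces Hurwitz's theorem, and it works
  even though the degree may drop in the limit. The imaginary shifts \<open>a m\<close> allow zooming in on
  roots that escape to infinity along the imaginary axis.\<close>

lemma limit_zeros_propagate_left:
  fixes p :: "nat \<Rightarrow> complex poly"
  assumes roots: "\<forall>\<^sub>F m in sequentially. \<forall>z. poly (p m) z = 0 \<longrightarrow> Re z \<le> - d"
    and shift: "\<And>m. Re (a m) = 0"
    and lim: "\<And>z. (\<lambda>m. c m * poly (p m) (a m + z)) \<longlonglongrightarrow> f z"
    and x: "f x = 0" and s: "0 \<le> s" "s \<le> 2 * (Re x + d)"
  shows "f (x - complex_of_real s) = 0"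
proof -
  have "norm (f (x - complex_of_real s)) \<le> norm (f x)"
  proof (rule tendsto_le[OF _ tendsto_norm[OF lim] tendsto_norm[OF lim]])
    show "\<forall>\<^sub>F m in sequentially. norm (c m * poly (p m) (a m + (x - complex_of_real s)))
        \<le> norm (c m * poly (p m) (a m + x))"
      using roots
    proof eventually_elim
      case (elim m)
      have "norm (poly (p m) (a m + x - complex_of_real s)) \<le> norm (poly (p m) (a m + x))"
        by (rule norm_poly_shift_left_le[of _ d]) (use elim s shift in auto)
      then show ?case by (simp add: norm_mult mult_left_mono add_diff_eq)
    qed
  qed simp
  with x show ?thesis by simp
qed

section \<open>Large frequencies: necessity of the criterion\<close>

text \<open>For \<open>\<tau> = 1 / (\<i> s)\<close> the condition on \<open>e\<close> says \<open>e \<theta> 1 = s\<^sup>2\<close>, and the left-hand side looks at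
  the dispersion polynomial near \<open>\<i> s\<close>, its approximate root at leading order. The point of the
  identity is that the right-hand side is a polynomial in \<open>\<tau>\<close>: the poles cancel, and for \<open>k \<ge> 1\<close>
  it equals \<open>2 z + 1 - \<theta> 2 / \<theta> 1\<close> at \<open>\<tau> = 0\<close>.\<close>

lemma rescaled_dispersion_poly:
  assumes "\<theta> 1 \<noteq> 0" and \<tau>: "\<tau> \<noteq> 0" and e: "complex_of_real e = - (1 / (complex_of_real (\<theta> 1) * \<tau>\<^sup>2))"
  shows "\<tau> ^ (k + 1) * poly (dispersion_poly k \<theta> e) (1 / \<tau> + z) =
    (1 + (z + 1) * \<tau>) ^ k * (2 * (z + 1) + (z + 1)\<^sup>2 * \<tau>) - (1 + (z + 1) * \<tau>) ^ (k + 1)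
    - (\<Sum>j = 2..k + 1. complex_of_real (\<theta> j / \<theta> 1) * (1 + (z + 1) * \<tau>) ^ (k + 1 - j) * \<tau> ^ (j - 2))"
proof -
  define q where "q = 1 + (z + 1) * \<tau>"
  have w: "1 / \<tau> + z + 1 = q / \<tau>" using \<tau> by (simp add: q_def field_simps)
  have term_eq: "\<tau> ^ (k + 1) * (complex_of_real e * (complex_of_real (\<theta> j) * (q / \<tau>) ^ (k + 1 - j)))
      = - (complex_of_real (\<theta> j / \<theta> 1) * q ^ (k + 1 - j) * (\<tau> ^ j / \<tau>\<^sup>2))" if "j \<le> k + 1" for j
  proof -
    have "\<tau> ^ (k + 1) = \<tau> ^ (k + 1 - j) * \<tau> ^ j" using that by (simp flip: power_add)
    then show ?thesis using \<tau> assms(1) unfolding e by (simp add: power_divide)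
  qed
  have "\<tau> ^ (k + 1) * poly (dispersion_poly k \<theta> e) (1 / \<tau> + z)
      = \<tau> ^ (k + 1) * ((q / \<tau> - 1) * (q / \<tau>) ^ (k + 1)) + (\<Sum>j = 1..k + 1.
        \<tau> ^ (k + 1) * (complex_of_real e * (complex_of_real (\<theta> j) * (q / \<tau>) ^ (k + 1 - j))))"
    unfolding poly_dispersion_poly poly_Q_poly w
    by (simp add: distrib_left sum_distrib_left algebra_simps flip: w del: sum.cl_ivl_Suc)
  also have "\<tau> ^ (k + 1) * ((q / \<tau> - 1) * (q / \<tau>) ^ (k + 1)) = (q / \<tau> - 1) * q ^ (k + 1)"
    using \<tau> by (simp add: power_divide)
  also have "(\<Sum>j = 1..k + 1. \<tau> ^ (k + 1) * (complex_of_real e * (complex_of_real (\<theta> j) * (q / \<tau>) ^ (k + 1 - j))))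
      = (\<Sum>j = 1..k + 1. - (complex_of_real (\<theta> j / \<theta> 1) * q ^ (k + 1 - j) * (\<tau> ^ j / \<tau>\<^sup>2)))"
    by (rule sum.cong[OF refl]) (rule term_eq, simp)
  also have "\<dots> = - (q ^ k / \<tau>)
      + (\<Sum>j = 2..k + 1. - (complex_of_real (\<theta> j / \<theta> 1) * q ^ (k + 1 - j) * (\<tau> ^ j / \<tau>\<^sup>2)))"
    using assms(1) \<tau> by (subst sum.atLeast_Suc_atMost) (simp_all add: numeral_2_eq_2 power2_eq_square)
  also have "(\<Sum>j = 2..k + 1. - (complex_of_real (\<theta> j / \<theta> 1) * q ^ (k + 1 - j) * (\<tau> ^ j / \<tau>\<^sup>2)))
      = - (\<Sum>j = 2..k + 1. complex_of_real (\<theta> j / \<theta> 1) * q ^ (k + 1 - j) * \<tau> ^ (j - 2))"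
    unfolding sum_negf[symmetric] using \<tau> by (intro sum.cong) (auto simp: power_diff)
  also have "(q / \<tau> - 1) * q ^ (k + 1) + (- (q ^ k / \<tau>) + -
        (\<Sum>j = 2..k + 1. complex_of_real (\<theta> j / \<theta> 1) * q ^ (k + 1 - j) * \<tau> ^ (j - 2)))
      = q ^ k * ((q\<^sup>2 - 1) / \<tau>) - q ^ (k + 1)
        - (\<Sum>j = 2..k + 1. complex_of_real (\<theta> j / \<theta> 1) * q ^ (k + 1 - j) * \<tau> ^ (j - 2))"
    by (simp add: algebra_simps power2_eq_square diff_divide_distrib del: sum.cl_ivl_Suc)
  also have "(q\<^sup>2 - 1) / \<tau> = 2 * (z + 1) + (z + 1)\<^sup>2 * \<tau>"
    using \<tau> by (simp add: q_def field_simps power2_eq_square)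
  finally show ?thesis unfolding q_def .
qed

text \<open>Both conditions come from limits of dispersion polynomials along large frequencies: divided by
  \<open>\<xi>\<^sup>2\<close> they tend to \<open>Q\<close>, and rescaled around \<open>\<i> \<xi> sqrt (\<theta> 1)\<close> they tend to the linear function with
  the root \<open>(\<theta> 2 / \<theta> 1 - 1) / 2\<close>. If a limit had a root with nonnegative real part, that root would
  propagate to a segment of roots.\<close>

lemma large_frequencies_necessary:
  assumes k: "k \<ge> 1" and pos: "\<theta> 1 > 0" and nonneg: "\<And>j. j \<in> {1..k + 1} \<Longrightarrow> \<theta> j \<ge> 0"
    and \<delta>: "\<delta> > 0"
    and gap: "\<And>\<xi>. \<bar>\<xi>\<bar> > R \<Longrightarrow> dispersion_roots k \<theta> \<xi> \<subseteq> {z. Re z \<le> - \<delta>}"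
  shows "\<theta> 2 < \<theta> 1"
    and "poly (map_poly complex_of_real (Q_poly k \<theta>)) x = 0 \<Longrightarrow> Re x < 0"
proof -
  define d where "d = min \<delta> 1"
  define q where "q = map_poly complex_of_real (Q_poly k \<theta>)"
  have d: "d > 0" using \<delta> by (simp add: d_def)
  \<comment> \<open>The cap at 1 in \<open>d\<close> covers a possible root of the polynomial at \<open>- 1\<close>.\<close>
  have roots: "Re z \<le> - d" if "\<bar>\<xi>\<bar> > R" "poly (dispersion_poly k \<theta> (\<xi>\<^sup>2)) z = 0" for \<xi> z
    using gap[OF that(1)] dispersion_roots_iff_poly[of z k \<theta> \<xi>] that(2)
    by (cases "z = - 1") (auto simp: d_def)
  have large: "\<forall>\<^sub>F m in sequentially. \<forall>z. poly (dispersion_poly k \<theta> ((c * real m)\<^sup>2)) z = 0 \<longrightarrow> Re z \<le> - d"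
    if "c > 0" for c
  proof -
    have "\<forall>\<^sub>F m in sequentially. R / c < real m"
      using filterlim_real_sequentially by (simp add: filterlim_at_top_dense)
    then show ?thesis
    proof eventually_elim
      case (elim m)
      then have "R < \<bar>c * real m\<bar>" using that by (simp add: field_simps abs_mult)
      then show ?case using roots by blast
    qed
  qed

  show "Re x < 0" if x: "poly (map_poly complex_of_real (Q_poly k \<theta>)) x = 0"
  proof (rule ccontr)
    assume "\<not> Re x < 0"
    have zero: "poly q (x - complex_of_real s) = 0" if "s \<in> {0..2 * d}" for s
    proof (rule limit_zeros_propagate_left[where p = "\<lambda>m. dispersion_poly k \<theta> ((real m)\<^sup>2)"
          and a = "\<lambda>_. 0" and c = "\<lambda>m. complex_of_real (inverse ((real m)\<^sup>2))" and d = d])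
      show "\<forall>\<^sub>F m in sequentially. \<forall>z. poly (dispersion_poly k \<theta> ((real m)\<^sup>2)) z = 0 \<longrightarrow> Re z \<le> - d"
        using large[of 1] by simp
      fix z
      have "(\<lambda>m. complex_of_real (inverse ((real m)\<^sup>2)) * (z * (z + 1) ^ (k + 1)) + poly q z)
          \<longlonglongrightarrow> complex_of_real (0\<^sup>2) * (z * (z + 1) ^ (k + 1)) + poly q z"
        unfolding power_inverse[symmetric]
        by (intro tendsto_intros lim_inverse_n)
      also have "complex_of_real (0\<^sup>2) * (z * (z + 1) ^ (k + 1)) + poly q z = poly q z" by simp
      finally show "(\<lambda>m. complex_of_real (inverse ((real m)\<^sup>2)) *
          poly (dispersion_poly k \<theta> ((real m)\<^sup>2)) (0 + z)) \<longlonglongrightarrow> poly q z"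
      proof (rule Lim_transform_eventually)
        show "\<forall>\<^sub>F m in sequentially. complex_of_real (inverse ((real m)\<^sup>2)) * (z * (z + 1) ^ (k + 1)) + poly q z
          = complex_of_real (inverse ((real m)\<^sup>2)) * poly (dispersion_poly k \<theta> ((real m)\<^sup>2)) (0 + z)"
          using eventually_gt_at_top[of 0]
          by eventually_elim (simp add: poly_dispersion_poly q_def field_simps)
      qed
    qed (use that x \<open>\<not> Re x < 0\<close> in \<open>auto simp: q_def\<close>)
    have "finite {z. poly q z = 0}"
      unfolding q_def by (intro poly_roots_finite Q_poly_nonzero pos nonneg)
    then have "finite ((\<lambda>s. x - complex_of_real s) ` {0..2 * d})"
      by (rule finite_subset[rotated]) (use zero in auto)
    then have "finite {0..2 * d}" by (rule finite_imageD) (auto simp: inj_on_def)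
    moreover have "infinite {0..2 * d}" using d by (intro infinite_Icc) simp
    ultimately show False by contradiction
  qed

  show "\<theta> 2 < \<theta> 1"
  proof (rule ccontr)
    assume "\<not> \<theta> 2 < \<theta> 1"
    define b where "b = \<theta> 2 / \<theta> 1"
    have b: "1 \<le> b" using pos \<open>\<not> \<theta> 2 < \<theta> 1\<close> by (simp add: b_def)
    define e where "e m = (1 / sqrt (\<theta> 1) * real m)\<^sup>2" for m :: nat
    define f where "f z = 2 * z + 1 - complex_of_real b" for z
    define \<tau> where "\<tau> m = inverse (\<i> * complex_of_real (real m))" for m :: nat
    have \<tau>0: "\<tau> \<longlonglongrightarrow> 0"
    proof -
      have "(\<lambda>m. - \<i> * complex_of_real (inverse (real m))) \<longlonglongrightarrow> - \<i> * complex_of_real 0"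
        by (intro tendsto_intros lim_inverse_n)
      then show ?thesis by (simp add: \<tau>_def[abs_def])
    qed
    have "f (complex_of_real ((b - 1) / 2) - complex_of_real d) = 0"
    proof (rule limit_zeros_propagate_left[where p = "\<lambda>m. dispersion_poly k \<theta> (e m)"
          and a = "\<lambda>m. \<i> * complex_of_real (real m)" and c = "\<lambda>m. \<tau> m ^ (k + 1)" and d = d])
      show "\<forall>\<^sub>F m in sequentially. \<forall>z. poly (dispersion_poly k \<theta> (e m)) z = 0 \<longrightarrow> Re z \<le> - d"
        unfolding e_def using pos by (intro large) simp
      fix z
      define F where "F t = (1 + (z + 1) * t) ^ k * (2 * (z + 1) + (z + 1)\<^sup>2 * t) - (1 + (z + 1) * t) ^ (k + 1)
        - (\<Sum>j = 2..k + 1. complex_of_real (\<theta> j / \<theta> 1) * (1 + (z + 1) * t) ^ (k + 1 - j) * t ^ (j - 2))" for t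
      have "(\<lambda>m. F (\<tau> m)) \<longlonglongrightarrow> F 0"
        unfolding F_def by (intro tendsto_intros \<tau>0)
      also have "F 0 = f z"
      proof -
        have "(\<Sum>j = 2..k + 1. complex_of_real (\<theta> j / \<theta> 1) * 0 ^ (j - 2))
            = (\<Sum>j \<in> {2}. complex_of_real (\<theta> j / \<theta> 1) * 0 ^ (j - 2))"
          using k by (intro sum.mono_neutral_right) auto
        then show ?thesis by (simp add: F_def f_def b_def del: sum.cl_ivl_Suc)
      qed
      finally show "(\<lambda>m. \<tau> m ^ (k + 1) * poly (dispersion_poly k \<theta> (e m))
          (\<i> * complex_of_real (real m) + z)) \<longlonglongrightarrow> f z"
      proof (rule Lim_transform_eventually)
        show "\<forall>\<^sub>F m in sequentially. F (\<tau> m) = \<tau> m ^ (k + 1) *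
            poly (dispersion_poly k \<theta> (e m)) (\<i> * complex_of_real (real m) + z)"
          using eventually_gt_at_top[of 0]
        proof eventually_elim
          case (elim m)
          have "complex_of_real (e m) = - (1 / (complex_of_real (\<theta> 1) * (\<tau> m)\<^sup>2))"
            using elim pos by (simp add: e_def \<tau>_def power_mult_distrib power_divide field_simps)
          moreover have "\<tau> m \<noteq> 0" using elim by (simp add: \<tau>_def)
          moreover have "1 / \<tau> m = \<i> * complex_of_real (real m)"
            unfolding \<tau>_def by (simp only: divide_inverse inverse_inverse_eq mult_1)
          ultimately show ?case
            using rescaled_dispersion_poly[of \<theta> "\<tau> m" "e m" k z] pos by (metis F_def less_irrefl)
        qed
      qed
    qed (use b d in \<open>auto simp: f_def field_simps\<close>)
    then show False using d by (simp add: f_def field_simps)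
  qed
qed

section \<open>The spectral characterization\<close>

theorem theorem1p1:
  fixes k :: nat and \<theta> :: "nat \<Rightarrow> real" and g :: "real \<Rightarrow> real"
  assumes "k \<ge> 1"
    and "\<And>t. t \<ge> 0 \<Longrightarrow> g t = (\<Sum>j = 1..k + 1. \<theta> j * gamma_pdf j t)"
    and "\<theta> 1 > 0"
    and "\<And>j. j \<in> {1..k + 1} \<Longrightarrow> \<theta> j \<ge> 0"
  shows
    "(\<exists>r > 0. \<exists>\<delta> > 0. \<exists>lam0 :: real \<Rightarrow> complex.
        (\<forall>\<xi>. \<bar>\<xi>\<bar> < r \<longrightarrow> dispersion_roots k \<theta> \<xi> \<inter> {z. Re z \<ge> - \<delta>} = {lam0 \<xi>}) \<and>
        (\<lambda>\<xi>. lam0 \<xi> - complex_of_real (- (\<Sum>j = 1..k + 1. \<theta> j) * \<xi>\<^sup>2))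
          \<in> o[at 0](\<lambda>\<xi>. complex_of_real (\<xi>\<^sup>2)))
     \<and>
     ((\<exists>R > 0. \<exists>\<delta> > 0. \<forall>\<xi>. \<bar>\<xi>\<bar> > R \<longrightarrow> dispersion_roots k \<theta> \<xi> \<subseteq> {z. Re z \<le> - \<delta>})
      \<longleftrightarrow>
      (\<theta> 2 < \<theta> 1 \<and>
       (\<forall>x :: complex. poly (map_poly complex_of_real (Q_poly k \<theta>)) x = 0 \<longrightarrow> Re x < 0)))"
proof (intro conjI iffI)
  show "\<exists>r > 0. \<exists>\<delta> > 0. \<exists>lam0 :: real \<Rightarrow> complex.
        (\<forall>\<xi>. \<bar>\<xi>\<bar> < r \<longrightarrow> dispersion_roots k \<theta> \<xi> \<inter> {z. Re z \<ge> - \<delta>} = {lam0 \<xi>}) \<and>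
        (\<lambda>\<xi>. lam0 \<xi> - complex_of_real (- (\<Sum>j = 1..k + 1. \<theta> j) * \<xi>\<^sup>2))
          \<in> o[at 0](\<lambda>\<xi>. complex_of_real (\<xi>\<^sup>2))"
    by (rule small_frequencies)
next
  assume "\<exists>R > 0. \<exists>\<delta> > 0. \<forall>\<xi>. \<bar>\<xi>\<bar> > R \<longrightarrow> dispersion_roots k \<theta> \<xi> \<subseteq> {z. Re z \<le> - \<delta>}"
  then obtain R \<delta> where "\<delta> > 0" and
    gap: "\<And>\<xi>. \<bar>\<xi>\<bar> > R \<Longrightarrow> dispersion_roots k \<theta> \<xi> \<subseteq> {z. Re z \<le> - \<delta>}"
    by blast
  note necessary = large_frequencies_necessary[where k = k and \<theta> = \<theta> and R = R, OF assms(1,3,4) \<open>\<delta> > 0\<close> gap]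
  show "\<theta> 2 < \<theta> 1" by (rule necessary(1))
  show "\<forall>x :: complex. poly (map_poly complex_of_real (Q_poly k \<theta>)) x = 0 \<longrightarrow> Re x < 0"
    using necessary(2) by blast
next
  assume "\<theta> 2 < \<theta> 1 \<and>
    (\<forall>x :: complex. poly (map_poly complex_of_real (Q_poly k \<theta>)) x = 0 \<longrightarrow> Re x < 0)"
  then show "\<exists>R > 0. \<exists>\<delta> > 0. \<forall>\<xi>. \<bar>\<xi>\<bar> > R \<longrightarrow> dispersion_roots k \<theta> \<xi> \<subseteq> {z. Re z \<le> - \<delta>}"
    using large_frequencies_sufficient[of k \<theta>] assms(1,3,4) by blast
qed

end
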